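(* Let $M,N,K$ be positive integers, $\mathbf A\in\mathbb R^{M\times N}$, $\lambda>0$, $\lambda_0>0$, $c_1=3$, $c_2=\|\mathbf A\|_F$. On $\mathbb R^{M\times K}\times\mathbb R^{K\times N}$ let $g(\mathbf U,\mathbf Z)=\frac12\|\mathbf A-\mathbf U\mathbf Z\|_F^2+\frac{\lambda_0}{2}(\|\mathbf U\|_F^2+\|\mathbf Z\|_F^2)$, $f(\mathbf U,\mathbf Z)=\mathbf I_{\mathbf U\ge\mathbf 0}+\mathbf I_{\mathbf Z\ge\mathbf 0}$, and $$h(\mathbf U,\mathbf Z)=c_1\Big(\tfrac{\|\mathbf U\|_F^2+\|\mathbf Z\|_F^2}{2}\Big)^2+(c_2+\lambda_0)\,\tfrac{\|\mathbf U\|_F^2+\|\mathbf Z\|_F^2}{2}.$$ Then the BPG-MF update $(\mathbf U^{k+1},\mathbf Z^{k+1})$ from $(\mathbf U^k,\mathbf Z^k)$ is given by $$\mathbf U^{k+1}=r\,\Pi_+(-\mathbf P^k),\qquad \mathbf Z^{k+1}=r\,\Pi_+(-\mathbf Q^k),$$ where $r\ge 0$ satisfies $$c_1\big(\|\Pi_+(-\mathbf Q^k)\|_F^2+\|\Pi_+(-\mathbf P^k)\|_F^2\big)r^3+(c_2+\lambda_0)r-1=0 .$$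
   Context: $\|\cdot\|_F$ and $\langle\cdot,\cdot\rangle$ are the Frobenius norm and inner product. $\mathbf I_{\mathbf X\ge\mathbf 0}$ is the indicator function equal to $0$ if all entries of $\mathbf X$ are non-negative and $+\infty$ otherwise. $\Pi_+(\cdot)=\max\{0,\cdot\}$ applied entrywise. BPG-MF update: given $\lambda>0$, functions $f,g,h$ on $\mathbb R^{M\times K}\times\mathbb R^{K\times N}$ with $g,h$ differentiable, and a current iterate $(\mathbf U^k,\mathbf Z^k)\in\mathbb R^{M\times K}\times\mathbb R^{K\times N}$, put $\mathbf P^k=\lambda\nabla_{\mathbf U}g(\mathbf U^k,\mathbf Z^k)-\nabla_{\mathbf U}h(\mathbf U^k,\mathbf Z^k)$ and $\mathbf Q^k=\lambda\nabla_{\mathbf Z}g(\mathbf U^k,\mathbf Z^k)-\nabla_{\mathbf Z}h(\mathbf U^k,\mathbf Z^k)$; the update is $$(\mathbf U^{k+1},\mathbf Z^{k+1})\in\operatorname*{argmin}_{(\mathbf U,\mathbf Z)\in\mathbb R^{M\times K}\times\mathbb R^{K\times N}}\{\lambda f(\mathbf U,\mathbf Z)+\langle\mathbf P^k,\mathbf U\rangle+\langle\mathbf Q^k,\mathbf Z\rangle+h(\mathbf U,\mathbf Z)\}.$$ *)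

theory Defs
  imports "HOL-Analysis.Analysis"
begin

text \<open>An \<open>M \<times> N\<close> matrix has type \<open>real ^ 'n ^ 'm\<close> with \<open>M = CARD('m)\<close>, \<open>N = CARD('n)\<close>.
  On this type the library's \<^const>\<open>norm\<close> and \<^const>\<open>inner\<close> are the Frobenius norm and
  inner product:\<close>

lemma inner_matrix_eq_sum:
  fixes X Y :: "real ^ 'n ^ 'm"
  shows "X \<bullet> Y = (\<Sum>i\<in>UNIV. \<Sum>j\<in>UNIV. X $ i $ j * Y $ i $ j)"
  by (simp add: inner_vec_def)

lemma norm_matrix_eq_sqrt_sum:
  fixes X :: "real ^ 'n ^ 'm"
  shows "norm X = sqrt (\<Sum>i\<in>UNIV. \<Sum>j\<in>UNIV. (X $ i $ j)\<^sup>2)"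
  by (simp add: norm_eq_sqrt_inner inner_matrix_eq_sum power2_eq_square)

text \<open>Unspecified where \<open>f\<close> is not differentiable.\<close>

definition grad :: "('a::real_inner \<Rightarrow> real) \<Rightarrow> 'a \<Rightarrow> 'a" where
  "grad f x = (THE D. GDERIV f x :> D)"

lemma grad_eqI:
  assumes "GDERIV f x :> D"
  shows "grad f x = D"
  unfolding grad_def
proof (rule the_equality)
  fix E assume "GDERIV f x :> E"
  then have "(\<lambda>h. h \<bullet> E) = (\<lambda>h. h \<bullet> D)"
    using assms unfolding gderiv_def by (rule has_derivative_unique)
  then have "\<forall>h. h \<bullet> E = h \<bullet> D" by (simp add: fun_eq_iff)
  then show "E = D" by (rule iffD1[OF vector_eq_ldot])
qed (rule assms)

lemma GDERIV_grad:
  fixes f :: "'a::euclidean_space \<Rightarrow> real"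
  assumes "f differentiable (at x)"
  shows "GDERIV f x :> grad f x"
proof -
  obtain f' where f': "(f has_derivative f') (at x)"
    using assms unfolding differentiable_def by (rule exE)
  then have lin: "linear f'"
    by (rule has_derivative_linear)
  have eq: "f' = (\<lambda>h. h \<bullet> adjoint f' 1)"
  proof
    fix h
    show "f' h = h \<bullet> adjoint f' 1"
      using adjoint_works[OF lin, of h 1] by simp
  qed
  have D: "GDERIV f x :> adjoint f' 1"
    unfolding gderiv_def by (rule has_derivative_eq_rhs[OF f' eq])
  show ?thesis
    unfolding grad_eqI[OF D] by (rule D)
qed

definition indicator_nonneg :: "real ^ 'n ^ 'm \<Rightarrow> ereal" where
  "indicator_nonneg X = (if \<forall>i j. 0 \<le> X $ i $ j then 0 else \<infinity>)"

definition Pi_plus :: "real ^ 'n ^ 'm \<Rightarrow> real ^ 'n ^ 'm" where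
  "Pi_plus X = (\<chi> i j. max 0 (X $ i $ j))"

definition bpg_P ::
  "real \<Rightarrow> ('u::real_inner \<times> 'z::real_inner \<Rightarrow> real) \<Rightarrow> ('u \<times> 'z \<Rightarrow> real) \<Rightarrow> 'u \<times> 'z \<Rightarrow> 'u" where
  "bpg_P lam g h = (\<lambda>(Uk, Zk). lam *\<^sub>R grad (\<lambda>U. g (U, Zk)) Uk - grad (\<lambda>U. h (U, Zk)) Uk)"

definition bpg_Q ::
  "real \<Rightarrow> ('u::real_inner \<times> 'z::real_inner \<Rightarrow> real) \<Rightarrow> ('u \<times> 'z \<Rightarrow> real) \<Rightarrow> 'u \<times> 'z \<Rightarrow> 'z" where
  "bpg_Q lam g h = (\<lambda>(Uk, Zk). lam *\<^sub>R grad (\<lambda>Z. g (Uk, Z)) Zk - grad (\<lambda>Z. h (Uk, Z)) Zk)"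

text \<open>The set of all admissible next iterates, i.e. the full argmin set.\<close>

definition bpg_mf_update ::
  "real \<Rightarrow> ((real ^ 'k ^ 'm) \<times> (real ^ 'n ^ 'k) \<Rightarrow> ereal)
    \<Rightarrow> ((real ^ 'k ^ 'm) \<times> (real ^ 'n ^ 'k) \<Rightarrow> real)
    \<Rightarrow> ((real ^ 'k ^ 'm) \<times> (real ^ 'n ^ 'k) \<Rightarrow> real)
    \<Rightarrow> (real ^ 'k ^ 'm) \<times> (real ^ 'n ^ 'k) \<Rightarrow> ((real ^ 'k ^ 'm) \<times> (real ^ 'n ^ 'k)) set" where
  "bpg_mf_update lam f g h xk =
    {x. is_arg_min
          (\<lambda>(U, Z). ereal lam * f (U, Z)
            + ereal (bpg_P lam g h xk \<bullet> U + bpg_Q lam g h xk \<bullet> Z + h (U, Z)))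
          (\<lambda>_. True) x}"

end

theory Submission
  imports Defs
begin

text \<open>Write \<open>p = (\<Pi>\<^sub>+(-P), \<Pi>\<^sub>+(-Q))\<close>. On the non-negative orthant, replacing \<open>(P, Q)\<close> by \<open>-p\<close>
  can only lower the linear term, and does not change it at the multiples of \<open>p\<close>
  (\<open>inner_Pi_plus_uminus_le\<close>, \<open>inner_Pi_plus_uminus\<close>). What remains is the unconstrained problem
  of minimising \<open>-(p \<bullet> x) + h x\<close>, where \<open>h\<close> is a function of \<open>\<parallel>x\<parallel>\<close> alone, so that its stationary
  point is a multiple \<open>r p\<close>, and the cubic says precisely that \<open>r p\<close> is stationary. Strong convexity
  of \<open>h\<close> yields a gap of \<open>\<parallel>x - r p\<parallel>\<^sup>2 / (2 r)\<close> between the values at \<open>x\<close> and \<open>r p\<close>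
  (\<open>quartic_gap\<close>). The lower bound is attained at the feasible point \<open>r p\<close>, so this point is the
  only minimiser of the constrained problem.\<close>

lemma cubic_has_nonneg_root:
  fixes a c :: real
  assumes "0 \<le> a" and "0 < c"
  shows "\<exists>r\<ge>0. a * r ^ 3 + c * r - 1 = 0"
proof -
  have "\<exists>r. 0 \<le> r \<and> r \<le> 1 / c \<and> a * r ^ 3 + c * r - 1 = 0"
    by (rule IVT') (use assms in \<open>auto intro!: continuous_intros\<close>)
  then show ?thesis by blast
qed

text \<open>With \<open>t = \<alpha> \<parallel>r p\<parallel>\<^sup>2 + c = 1 / r\<close>, the vector \<open>t (r p) = p\<close> is the gradient of the radial part
  at \<open>r p\<close>. Bounding \<open>s \<mapsto> \<alpha> s\<^sup>2 + c s\<close> at \<open>s = \<parallel>x\<parallel>\<^sup>2 / 2\<close> below by its tangent at \<open>\<parallel>r p\<parallel>\<^sup>2 / 2\<close>,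
  whose slope is \<open>t\<close>, leaves a quadratic in \<open>x\<close>, and completing the square gives the gap.\<close>

lemma quartic_gap:
  fixes p x :: "'a::real_inner"
  assumes "0 \<le> \<alpha>" and "0 < r" and root: "\<alpha> * (norm p)\<^sup>2 * r ^ 3 + c * r = 1"
  defines "H \<equiv> \<lambda>x :: 'a. \<alpha> * ((norm x)\<^sup>2 / 2)\<^sup>2 + c * ((norm x)\<^sup>2 / 2)"
  shows "- (p \<bullet> (r *\<^sub>R p)) + H (r *\<^sub>R p) + (norm (x - r *\<^sub>R p))\<^sup>2 / (2 * r) \<le> - (p \<bullet> x) + H x"
proof -
  define w v where "w = (norm x)\<^sup>2" and "v = (norm (r *\<^sub>R p))\<^sup>2"
  have v: "v = r\<^sup>2 * (norm p)\<^sup>2"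
    by (simp add: v_def power_mult_distrib)
  have slope: "\<alpha> * v + c = 1 / r"
    using root \<open>0 < r\<close> by (simp add: v field_simps power2_eq_square power3_eq_cube)
  have "0 \<le> \<alpha> * (w - v)\<^sup>2 / 4"
    using \<open>0 \<le> \<alpha>\<close> by simp
  also have "\<dots> = H x - H (r *\<^sub>R p) - (\<alpha> * v + c) * (w - v) / 2"
    unfolding H_def w_def[symmetric] v_def[symmetric] by (simp add: field_simps power2_eq_square)
  finally have tangent: "H (r *\<^sub>R p) + (w - v) / (2 * r) \<le> H x"
    by (simp add: slope)
  have "(norm (x - r *\<^sub>R p))\<^sup>2 = w - 2 * r * (p \<bullet> x) + v"
    unfolding w_def v_def power2_norm_eq_inner
    by (simp add: inner_diff_left inner_diff_right inner_commute)
  moreover have "p \<bullet> (r *\<^sub>R p) = v / r"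
    using \<open>0 < r\<close> unfolding v power2_norm_eq_inner by (simp add: power2_eq_square)
  ultimately have "(w - v) / (2 * r) = (norm (x - r *\<^sub>R p))\<^sup>2 / (2 * r) + p \<bullet> x - p \<bullet> (r *\<^sub>R p)"
    using \<open>0 < r\<close> by (simp add: field_simps)
  with tangent show ?thesis by linarith
qed

lemma inner_Pi_plus_uminus_le:
  assumes "\<forall>i j. 0 \<le> U $ i $ j"
  shows "- (Pi_plus (- P) \<bullet> U) \<le> P \<bullet> U"
proof -
  have "0 \<le> (P + Pi_plus (- P)) \<bullet> U"
    unfolding inner_matrix_eq_sum
    by (intro sum_nonneg mult_nonneg_nonneg) (use assms in \<open>auto simp: Pi_plus_def\<close>)
  then show ?thesis by (simp add: inner_add_left)
qed

lemma inner_Pi_plus_uminus: "P \<bullet> Pi_plus (- P) = - (Pi_plus (- P) \<bullet> Pi_plus (- P))"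
proof -
  have "(P + Pi_plus (- P)) \<bullet> Pi_plus (- P) = 0"
    unfolding inner_matrix_eq_sum by (intro sum.neutral ballI) (auto simp: Pi_plus_def max_def)
  then show ?thesis by (simp add: inner_add_left)
qed

lemma Pi_plus_nonneg: "0 \<le> Pi_plus X $ i $ j"
  by (simp add: Pi_plus_def)

lemma is_arg_min_set_eq_singleton:
  fixes F :: "'a \<Rightarrow> 'b::order"
  assumes "\<And>y. y \<noteq> x \<Longrightarrow> F x < F y"
  shows "{y. is_arg_min F (\<lambda>_. True) y} = {x}"
  using assms by (force simp: is_arg_min_def)

theorem propositionD2:
  fixes A :: "real ^ 'n ^ 'm"
    and lam lam0 c1 c2 :: real
    and f :: "(real ^ 'k ^ 'm) \<times> (real ^ 'n ^ 'k) \<Rightarrow> ereal"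
    and g h :: "(real ^ 'k ^ 'm) \<times> (real ^ 'n ^ 'k) \<Rightarrow> real"
    and Uk P :: "real ^ 'k ^ 'm"
    and Zk Q :: "real ^ 'n ^ 'k"
  assumes "lam > 0"
    and "lam0 > 0"
    and "c1 = 3"
    and "c2 = norm A"
    and "g = (\<lambda>(U, Z). 1/2 * (norm (A - U ** Z))\<^sup>2 + lam0/2 * ((norm U)\<^sup>2 + (norm Z)\<^sup>2))"
    and "f = (\<lambda>(U, Z). indicator_nonneg U + indicator_nonneg Z)"
    and "h = (\<lambda>(U, Z). c1 * (((norm U)\<^sup>2 + (norm Z)\<^sup>2) / 2)\<^sup>2
                 + (c2 + lam0) * (((norm U)\<^sup>2 + (norm Z)\<^sup>2) / 2))"
    and "P = bpg_P lam g h (Uk, Zk)"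
    and "Q = bpg_Q lam g h (Uk, Zk)"
  shows "(\<exists>r\<ge>0. c1 * ((norm (Pi_plus (- Q)))\<^sup>2 + (norm (Pi_plus (- P)))\<^sup>2) * r^3
                  + (c2 + lam0) * r - 1 = 0)
    \<and> (\<forall>r\<ge>0. c1 * ((norm (Pi_plus (- Q)))\<^sup>2 + (norm (Pi_plus (- P)))\<^sup>2) * r^3
                  + (c2 + lam0) * r - 1 = 0
          \<longrightarrow> bpg_mf_update lam f g h (Uk, Zk)
                = {(r *\<^sub>R Pi_plus (- P), r *\<^sub>R Pi_plus (- Q))})"
proof -
  define c where "c = c2 + lam0"
  have "0 < c"
    using assms(2,4) by (simp add: c_def add_nonneg_pos)
  have "0 \<le> c1"
    using assms(3) by simp
  define a b where "a = Pi_plus (- P)" and "b = Pi_plus (- Q)"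
  define F where "F = (\<lambda>(U, Z). ereal lam * f (U, Z) + ereal (P \<bullet> U + Q \<bullet> Z + h (U, Z)))"
  have update: "bpg_mf_update lam f g h (Uk, Zk) = {x. is_arg_min F (\<lambda>_. True) x}"
    by (simp add: bpg_mf_update_def F_def assms(8,9))
  define nonneg where
    "nonneg = (\<lambda>(U :: real ^ 'k ^ 'm, Z :: real ^ 'n ^ 'k).
       (\<forall>i j. 0 \<le> U $ i $ j) \<and> (\<forall>i j. 0 \<le> Z $ i $ j))"
  have F_in: "F (U, Z) = ereal (P \<bullet> U + Q \<bullet> Z + h (U, Z))" if "nonneg (U, Z)" for U Z
    using that by (simp add: F_def assms(6) nonneg_def indicator_nonneg_def flip: zero_ereal_def)
  have F_out: "F (U, Z) = \<infinity>" if "\<not> nonneg (U, Z)" for U Z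
    using that assms(1) by (auto simp: F_def assms(6) nonneg_def indicator_nonneg_def)
  have h_eq: "h x = c1 * ((norm x)\<^sup>2 / 2)\<^sup>2 + c * ((norm x)\<^sup>2 / 2)" for x
    by (cases x) (simp add: assms(7) c_def norm_Pair)
  have unique: "{x. is_arg_min F (\<lambda>_. True) x} = {(r *\<^sub>R a, r *\<^sub>R b)}"
    if "0 \<le> r" and root: "c1 * ((norm b)\<^sup>2 + (norm a)\<^sup>2) * r ^ 3 + c * r - 1 = 0" for r
  proof (rule is_arg_min_set_eq_singleton)
    have "r \<noteq> 0"
      using root by auto
    with \<open>0 \<le> r\<close> have "0 < r"
      by simp
    have root': "c1 * (norm (a, b))\<^sup>2 * r ^ 3 + c * r = 1"
      using root by (simp add: norm_Pair add.commute)
    have opt_feasible: "nonneg (r *\<^sub>R a, r *\<^sub>R b)"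
      using \<open>0 \<le> r\<close> by (simp add: nonneg_def a_def b_def Pi_plus_nonneg)
    have opt_linear: "P \<bullet> (r *\<^sub>R a) + Q \<bullet> (r *\<^sub>R b) = - ((a, b) \<bullet> (r *\<^sub>R (a, b)))"
      by (simp add: a_def b_def inner_Pi_plus_uminus algebra_simps)
    fix y :: "(real ^ 'k ^ 'm) \<times> (real ^ 'n ^ 'k)"
    assume y: "y \<noteq> (r *\<^sub>R a, r *\<^sub>R b)"
    obtain U Z where UZ: "y = (U, Z)"
      by fastforce
    show "F (r *\<^sub>R a, r *\<^sub>R b) < F y"
    proof (cases "nonneg y")
      case True
      have "- ((a, b) \<bullet> y) \<le> P \<bullet> U + Q \<bullet> Z"
        using True inner_Pi_plus_uminus_le[of U P] inner_Pi_plus_uminus_le[of Z Q]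
        by (simp add: UZ nonneg_def a_def b_def)
      moreover have "0 < (norm (y - r *\<^sub>R (a, b)))\<^sup>2 / (2 * r)"
        using y \<open>0 < r\<close> by simp
      ultimately have "P \<bullet> (r *\<^sub>R a) + Q \<bullet> (r *\<^sub>R b) + h (r *\<^sub>R (a, b)) < P \<bullet> U + Q \<bullet> Z + h y"
        using quartic_gap[OF \<open>0 \<le> c1\<close> \<open>0 < r\<close> root', of y] unfolding h_eq opt_linear by linarith
      then show ?thesis
        using True opt_feasible by (simp add: UZ F_in)
    next
      case False
      then show ?thesis
        using opt_feasible by (simp add: UZ F_in F_out)
    qed
  qed
  show ?thesis
    using cubic_has_nonneg_root[of "c1 * ((norm b)\<^sup>2 + (norm a)\<^sup>2)" c] \<open>0 \<le> c1\<close> \<open>0 < c\<close> unique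
    unfolding update a_def b_def c_def by simp
qed

end
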